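(* Let $p\in\Sigma^*$ be a binary pattern with reversal. If $\ell(p)$ is a prefix of one of $xyx$ and $xyx^R$, then $p$ is unavoidable; otherwise $p$ is $3$-avoidable.
   Context: $\Sigma=\{x,x^R,y,y^R\}$ is a four-letter alphabet; a word $p\in\Sigma^*$ is called a binary pattern with reversal. For a positive integer $k$, $T_k=\{0,1,\ldots,k-1\}$. For a word $w=a_1a_2\cdots a_n\in T_k^*$ ($a_i\in T_k$), $w^R=a_na_{n-1}\cdots a_1$ is its reversal. A morphism $f:\Sigma^*\to T_k^*$ respects reversal if $f(x^R)=f(x)^R$ and $f(y^R)=f(y)^R$. An instance of $p$ is the image of $p$ under some non-erasing morphism that respects reversal (non-erasing: the image of every letter is non-empty). A word $w$ avoids $p$ if no factor (contiguous subword) of $w$ is an instance of $p$. The pattern $p$ is $k$-avoidable if there are arbitrarily long words of $T_k^*$ which avoid $p$; $p$ is avoidable if it is $k$-avoidable for some positive integer $k$, and otherwise it is unavoidable. Let $\iota_1,\iota_2$ be the morphisms of $\Sigma^*$ with $\iota_1(x)=x^R$, $\iota_1(x^R)=x$, $\iota_1(y)=y$, $\iota_1(y^R)=y^R$, and $\iota_2(x)=y$, $\iota_2(x^R)=y^R$, $\iota_2(y)=x$, $\iota_2(y^R)=x^R$. Let $\iota_3$ be the reversal antimorphism of $\Sigma^*$, $\iota_3(a_1a_2\cdots a_n)=a_n\cdots a_2a_1$ for $a_i\in\Sigma$. Write $p\sim q$ if $q$ is obtained from $p$ by a (finite) sequence of applications of $\iota_1,\iota_2,\iota_3$; this is an equivalence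 relation on $\Sigma^*$. For $p\in\Sigma^*$, $\ell(p)$ is the least element of the $\sim$-equivalence class of $p$ in the lexicographic order generated by $x<x^R<y<y^R$. (All elements of a class have the same length.) *)

theory Defs
  imports "HOL-Library.Sublist" "HOL-Library.List_Lexorder"
begin

datatype letter = X | XR | Y | YR

instantiation letter :: linorder
begin

primrec letter_rank :: "letter \<Rightarrow> nat" where
  "letter_rank X = 0"
| "letter_rank XR = 1"
| "letter_rank Y = 2"
| "letter_rank YR = 3"

definition less_eq_letter :: "letter \<Rightarrow> letter \<Rightarrow> bool" where
  "a \<le> b \<longleftrightarrow> letter_rank a \<le> letter_rank b"

definition less_letter :: "letter \<Rightarrow> letter \<Rightarrow> bool" where
  "a < b \<longleftrightarrow> letter_rank a < letter_rank b"

instance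
proof
  fix a b :: letter
  show "a = b" if "a \<le> b" "b \<le> a"
    using that by (cases a; cases b; simp add: less_eq_letter_def)
qed (auto simp: less_eq_letter_def less_letter_def)

end

type_synonym pattern = "letter list"

definition words :: "nat \<Rightarrow> nat list set" where
  "words k = lists {..<k}"

definition morphism :: "nat \<Rightarrow> (letter list \<Rightarrow> nat list) \<Rightarrow> bool" where
  "morphism k f \<longleftrightarrow> range f \<subseteq> words k \<and> (\<forall>u v. f (u @ v) = f u @ f v)"

definition non_erasing :: "(letter list \<Rightarrow> nat list) \<Rightarrow> bool" where
  "non_erasing f \<longleftrightarrow> (\<forall>a. f [a] \<noteq> [])"

definition respects_reversal :: "(letter list \<Rightarrow> nat list) \<Rightarrow> bool" where
  "respects_reversal f \<longleftrightarrow> f [XR] = rev (f [X]) \<and> f [YR] = rev (f [Y])"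

definition is_instance :: "nat \<Rightarrow> pattern \<Rightarrow> nat list \<Rightarrow> bool" where
  "is_instance k p u \<longleftrightarrow>
     (\<exists>f. morphism k f \<and> non_erasing f \<and> respects_reversal f \<and> u = f p)"

definition avoids :: "nat \<Rightarrow> nat list \<Rightarrow> pattern \<Rightarrow> bool" where
  "avoids k w p \<longleftrightarrow> \<not> (\<exists>u. sublist u w \<and> is_instance k p u)"

definition k_avoidable :: "nat \<Rightarrow> pattern \<Rightarrow> bool" where
  "k_avoidable k p \<longleftrightarrow> (\<forall>n. \<exists>w \<in> words k. n \<le> length w \<and> avoids k w p)"

definition avoidable :: "pattern \<Rightarrow> bool" where
  "avoidable p \<longleftrightarrow> (\<exists>k>0. k_avoidable k p)"

definition unavoidable :: "pattern \<Rightarrow> bool" where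
  "unavoidable p \<longleftrightarrow> \<not> avoidable p"

primrec iota1_letter :: "letter \<Rightarrow> letter" where
  "iota1_letter X = XR"
| "iota1_letter XR = X"
| "iota1_letter Y = Y"
| "iota1_letter YR = YR"

primrec iota2_letter :: "letter \<Rightarrow> letter" where
  "iota2_letter X = Y"
| "iota2_letter XR = YR"
| "iota2_letter Y = X"
| "iota2_letter YR = XR"

definition iota1 :: "pattern \<Rightarrow> pattern" where
  "iota1 = map iota1_letter"

definition iota2 :: "pattern \<Rightarrow> pattern" where
  "iota2 = map iota2_letter"

(* Only the order of the letters is reversed: x and x^R are not exchanged. *)
definition iota3 :: "pattern \<Rightarrow> pattern" where
  "iota3 = rev"

definition iota_step :: "pattern \<Rightarrow> pattern \<Rightarrow> bool" where
  "iota_step p q \<longleftrightarrow> q = iota1 p \<or> q = iota2 p \<or> q = iota3 p"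

definition sim :: "pattern \<Rightarrow> pattern \<Rightarrow> bool" where
  "sim = iota_step\<^sup>*\<^sup>*"

definition ell :: "pattern \<Rightarrow> pattern" where
  "ell p = (LEAST q. sim p q)"

lemma iota_invol:
  "iota1 (iota1 p) = p" "iota2 (iota2 p) = p" "iota3 (iota3 p) = p"
proof -
  have "iota1_letter (iota1_letter a) = a" "iota2_letter (iota2_letter a) = a" for a
    by (cases a; simp)+
  then show "iota1 (iota1 p) = p" "iota2 (iota2 p) = p" "iota3 (iota3 p) = p"
    by (simp_all add: iota1_def iota2_def iota3_def o_def map_idI)
qed

lemma equivp_sim: "equivp sim"
proof (rule equivpI)
  have "symp iota_step"
    by (rule sympI) (auto simp: iota_step_def iota_invol)
  then show "symp sim"
    unfolding sim_def by (simp add: symp_rtranclp)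
  show "reflp sim" "transp sim"
    by (auto simp: sim_def intro!: reflpI transpI)
qed

lemma sim_length: "sim p q \<Longrightarrow> length q = length p"
  unfolding sim_def
  by (induction rule: rtranclp_induct)
     (auto simp: iota_step_def iota1_def iota2_def iota3_def)

lemma finite_sim_class: "finite {q. sim p q}"
proof -
  have "(UNIV :: letter set) \<subseteq> {X, XR, Y, YR}"
    using letter.exhaust by blast
  then have "finite (UNIV :: letter set)"
    by (rule finite_subset) simp
  then have "finite {q :: pattern. set q \<subseteq> UNIV \<and> length q = length p}"
    by (rule finite_lists_length_eq)
  then show ?thesis
    by (rule finite_subset[rotated]) (auto dest: sim_length)
qed

lemma ell_eq_Min: "ell p = Min {q. sim p q}"
proof -
  have "sim p p" by (simp add: sim_def)
  then show ?thesis
    unfolding ell_def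
    by (intro Least_equality)
       (use finite_sim_class[of p] Min_in[OF finite_sim_class] in auto)
qed

lemma sim_ell: "sim p (ell p)"
proof -
  have "sim p p" by (simp add: sim_def)
  then show ?thesis
    using Min_in[OF finite_sim_class, of p] by (auto simp: ell_eq_Min)
qed

lemma ell_le: "sim p q \<Longrightarrow> ell p \<le> q"
  by (simp add: ell_eq_Min finite_sim_class)

end

(* By the pigeonhole principle every long word has a factor aBa with a a letter and B nonempty,
   so xyx and xyx^R are unavoidable. A representative of any other class contains two adjacent
   occurrences of the same variable, or four letters alternating between the variables (reversed
   or not).  The former are avoided by a square-free ternary sequence (an even palindrome contains
   the square of its middle letter).  The latter are avoided by a ternary sequence whose steps are
   0 or +1 modulo 3 and whose only squares have period one: if A and its reversal both occur in it,
   then A is constant, so an instance would be a square (AB)(AB).  Both sequences are images of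
   square-free sequences under uniform substitutions commuting with the cyclic shift of letters. *)

theory Submission
  imports Defs
begin

section \<open>Instances of patterns\<close>

primrec letter_image :: "'a list \<Rightarrow> 'a list \<Rightarrow> letter \<Rightarrow> 'a list" where
  "letter_image A B X = A"
| "letter_image A B XR = rev A"
| "letter_image A B Y = B"
| "letter_image A B YR = rev B"

definition pattern_image :: "'a list \<Rightarrow> 'a list \<Rightarrow> pattern \<Rightarrow> 'a list" where
  "pattern_image A B p = concat (map (letter_image A B) p)"

lemma pattern_image_simps [simp]:
  "pattern_image A B [] = []"
  "pattern_image A B (a # p) = letter_image A B a @ pattern_image A B p"
  "pattern_image A B (p @ q) = pattern_image A B p @ pattern_image A B q"
  by (simp_all add: pattern_image_def)

text \<open>A morphism that respects reversal is determined by its values \<open>A\<close> on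
  \<open>X\<close> and \<open>B\<close> on \<open>Y\<close>, and any two nonempty words over the
  alphabet extend to such a morphism. From here on, pairs of words replace morphisms.\<close>

lemma is_instance_iff:
  "is_instance k p u \<longleftrightarrow>
     (\<exists>A\<in>words k. \<exists>B\<in>words k. A \<noteq> [] \<and> B \<noteq> [] \<and> u = pattern_image A B p)"
proof
  assume "is_instance k p u"
  then obtain f where f: "morphism k f" "non_erasing f" "respects_reversal f" "u = f p"
    by (auto simp: is_instance_def)
  have app: "f (v @ w) = f v @ f w" for v w
    using f(1) by (simp add: morphism_def)
  have nil: "f [] = []"
    using app[of "[]" "[]"] by simp
  have letter: "f [a] = letter_image (f [X]) (f [Y]) a" for a
    using f(3) by (cases a) (simp_all add: respects_reversal_def)
  have "f q = pattern_image (f [X]) (f [Y]) q" for q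
  proof (induction q)
    case (Cons a q)
    then show ?case using app[of "[a]" q] letter[of a] by simp
  qed (simp add: nil)
  moreover have "f [X] \<in> words k" "f [Y] \<in> words k" "f [X] \<noteq> []" "f [Y] \<noteq> []"
    using f(1,2) by (auto simp: morphism_def non_erasing_def)
  ultimately show "\<exists>A\<in>words k. \<exists>B\<in>words k. A \<noteq> [] \<and> B \<noteq> [] \<and> u = pattern_image A B p"
    using f(4) by metis
next
  assume "\<exists>A\<in>words k. \<exists>B\<in>words k. A \<noteq> [] \<and> B \<noteq> [] \<and> u = pattern_image A B p"
  then obtain A B where AB: "A \<in> words k" "B \<in> words k" "A \<noteq> []" "B \<noteq> []"
    "u = pattern_image A B p" by blast
  have letter: "letter_image A B a \<in> words k" "letter_image A B a \<noteq> []" for a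
    using AB(1-4) by (cases a; auto simp: words_def)+
  have "pattern_image A B q \<in> words k" for q
    by (induction q) (use letter(1) in \<open>auto simp: words_def\<close>)
  then have "morphism k (pattern_image A B)"
    by (auto simp: morphism_def)
  then show "is_instance k p u"
    unfolding is_instance_def using letter(2) AB(5)
    by (intro exI[of _ "pattern_image A B"])
       (auto simp: non_erasing_def respects_reversal_def)
qed

lemma avoidsI:
  assumes "\<And>A B. A \<in> words k \<Longrightarrow> B \<in> words k \<Longrightarrow> A \<noteq> [] \<Longrightarrow> B \<noteq> [] \<Longrightarrow>
    sublist (pattern_image A B p) w \<Longrightarrow> False"
  shows "avoids k w p"
  using assms unfolding avoids_def is_instance_iff by blast

lemma avoidsD:
  assumes "avoids k w p" "A \<in> words k" "B \<in> words k" "A \<noteq> []" "B \<noteq> []"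
    "sublist (pattern_image A B p) w"
  shows False
  using assms unfolding avoids_def is_instance_iff by blast

lemma avoids_sublist:
  assumes "avoids k w q" "sublist q p"
  shows "avoids k w p"
proof (rule avoidsI)
  fix A B assume AB: "A \<in> words k" "B \<in> words k" "A \<noteq> []" "B \<noteq> []"
    and sub: "sublist (pattern_image A B p) w"
  have "sublist (pattern_image A B q) (pattern_image A B p)"
    using assms(2) by (force simp: sublist_def)
  then have "sublist (pattern_image A B q) w"
    using sub sublist_order.order.trans by blast
  then show False using avoidsD[OF assms(1) AB] by blast
qed

lemma k_avoidable_sublist:
  "k_avoidable k q \<Longrightarrow> sublist q p \<Longrightarrow> k_avoidable k p"
  unfolding k_avoidable_def using avoids_sublist by blast

section \<open>Invariance of avoidability under the equivalence of patterns\<close>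

lemma pattern_image_iota:
  "pattern_image A B (iota1 p) = pattern_image (rev A) B p"
  "pattern_image A B (iota2 p) = pattern_image B A p"
  "pattern_image A B (iota3 p) = rev (pattern_image (rev A) (rev B) p)"
proof -
  have "letter_image A B (iota1_letter a) = letter_image (rev A) B a"
    "letter_image A B (iota2_letter a) = letter_image B A a"
    "rev (letter_image (rev A) (rev B) a) = letter_image A B a" for a
    by (cases a; simp)+
  then show "pattern_image A B (iota1 p) = pattern_image (rev A) B p"
    "pattern_image A B (iota2 p) = pattern_image B A p"
    "pattern_image A B (iota3 p) = rev (pattern_image (rev A) (rev B) p)"
    by (simp_all add: pattern_image_def iota1_def iota2_def iota3_def rev_concat rev_map o_def)
qed

lemma rev_in_words [simp]: "rev w \<in> words k \<longleftrightarrow> w \<in> words k"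
  by (auto simp: words_def)

text \<open>The changes made by \<open>iota1\<close> and \<open>iota2\<close> are absorbed into the
  choice of \<open>A\<close> and \<open>B\<close>, so the same word works; \<open>iota3\<close> also
  reverses the whole image and calls for \<open>rev w\<close>.\<close>

lemma k_avoidable_iota_step:
  assumes "k_avoidable k p" "iota_step p q"
  shows "k_avoidable k q"
  unfolding k_avoidable_def
proof
  fix n
  obtain w where w: "w \<in> words k" "n \<le> length w" "avoids k w p"
    using assms(1) by (auto simp: k_avoidable_def)
  from assms(2) consider "q = iota1 p" | "q = iota2 p" | "q = iota3 p"
    by (auto simp: iota_step_def)
  then have "avoids k w q \<or> avoids k (rev w) q"
  proof cases
    case 1
    have "avoids k w q"
      by (rule avoidsI) (use avoidsD[OF w(3), of "rev A" B for A B] in \<open>auto simp: 1 pattern_image_iota\<close>)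
    then show ?thesis ..
  next
    case 2
    have "avoids k w q"
      by (rule avoidsI) (use avoidsD[OF w(3), of B A for A B] in \<open>auto simp: 2 pattern_image_iota\<close>)
    then show ?thesis ..
  next
    case 3
    have "avoids k (rev w) q"
      by (rule avoidsI) (use avoidsD[OF w(3), of "rev A" "rev B" for A B] in \<open>auto simp: 3 pattern_image_iota sublist_rev_right\<close>)
    then show ?thesis ..
  qed
  then show "\<exists>w\<in>words k. n \<le> length w \<and> avoids k w q"
    using w(1,2) rev_in_words length_rev by metis
qed

lemma k_avoidable_sim:
  assumes "sim p q"
  shows "k_avoidable k p \<longleftrightarrow> k_avoidable k q"
proof -
  have *: "k_avoidable k b" if "sim a b" "k_avoidable k a" for a b
    using that unfolding sim_def
    by (induction rule: rtranclp_induct) (auto intro: k_avoidable_iota_step)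
  show ?thesis
    using assms * equivp_symp[OF equivp_sim] by blast
qed

section \<open>Unavoidable patterns\<close>

text \<open>The k + 1 even positions from 0 to 2k hold at most k letters, so two of them agree. Even
  positions are never adjacent, which makes \<open>B\<close> nonempty.\<close>

lemma word_contains_repeated_letter:
  assumes "w \<in> words k" "2 * k < length w"
  obtains c B where "c < k" "B \<in> words k" "B \<noteq> []" "sublist ([c] @ B @ [c]) w"
proof -
  let ?f = "\<lambda>i. w ! (2 * i)"
  have nth: "w ! i < k" if "i < length w" for i
    using assms(1) that nth_mem by (force simp: words_def)
  have "?f ` {..k} \<subseteq> {..<k}"
    using assms(2) nth by auto
  then have "card (?f ` {..k}) < card {..k}"
    using card_mono[of "{..<k}" "?f ` {..k}"] by simp
  then have "\<not> inj_on ?f {..k}" by (rule pigeonhole)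
  then obtain i j where "i \<le> k" "j \<le> k" "i \<noteq> j" "?f i = ?f j"
    by (auto simp: inj_on_def)
  then obtain i j where ij: "i < j" "j \<le> k" "?f i = ?f j"
    by (metis linorder_neqE_nat)
  define B where "B = take (2 * j - Suc (2 * i)) (drop (Suc (2 * i)) w)"
  have "drop (2 * i) w = w ! (2 * i) # drop (Suc (2 * i)) w"
    using ij assms(2) by (intro Cons_nth_drop_Suc[symmetric]) simp
  moreover have "drop (Suc (2 * i)) w = B @ drop (2 * j) w"
    using append_take_drop_id[of "2 * j - Suc (2 * i)" "drop (Suc (2 * i)) w"] ij
    by (simp add: B_def)
  moreover have "drop (2 * j) w = w ! (2 * i) # drop (Suc (2 * j)) w"
    using ij assms(2) Cons_nth_drop_Suc[of "2 * j" w] by simp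
  ultimately have w: "w = take (2 * i) w @ ([?f i] @ B @ [?f i]) @ drop (Suc (2 * j)) w"
    using append_take_drop_id[of "2 * i" w] by simp
  show thesis
  proof
    show "?f i < k" using nth ij assms(2) by simp
    show "B \<in> words k"
      using assms(1) set_take_subset set_drop_subset unfolding B_def words_def
      by (metis in_lists_conv_set subset_code(1))
    have "length B = 2 * j - Suc (2 * i)"
      unfolding B_def using ij assms(2) by simp
    then show "B \<noteq> []" using ij by auto
    show "sublist ([?f i] @ B @ [?f i]) w"
      unfolding sublist_def using w by blast
  qed
qed

lemma unavoidable_maximal:
  assumes "p = [X, Y, X] \<or> p = [X, Y, XR]"
  shows "\<not> k_avoidable k p"
proof
  assume "k_avoidable k p"
  then obtain w where w: "w \<in> words k" "Suc (2 * k) \<le> length w" "avoids k w p"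
    unfolding k_avoidable_def by blast
  then obtain c B where cB: "c < k" "B \<in> words k" "B \<noteq> []" "sublist ([c] @ B @ [c]) w"
    using word_contains_repeated_letter by (metis Suc_le_eq)
  \<comment> \<open>The one-letter word \<open>[c]\<close> is a palindrome, so \<open>X\<close> and
    \<open>XR\<close> have the same image.\<close>
  have "pattern_image [c] B p = [c] @ B @ [c]"
    using assms by auto
  then show False
    using avoidsD[OF w(3), of "[c]" B] cB by (simp add: words_def)
qed

section \<open>Substitutions commuting with cyclic shifts\<close>

lemma mod_3_add_difference:
  fixes a b x :: nat
  assumes "a < 3"
  shows "(b + x) mod 3 = (a + (x + (b + 3 - a) mod 3) mod 3) mod 3"
proof -
  \<comment> \<open>The term \<open>b + 3 - a\<close> stands for the residue of b - a; the added 3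
    prevents truncated subtraction, since \<open>a < 3\<close>.\<close>
  have "(a + (x + (b + 3 - a) mod 3) mod 3) mod 3 = (a + (x + (b + 3 - a))) mod 3"
    by (simp only: mod_simps)
  also have "a + (x + (b + 3 - a)) = b + x + 3" using assms by simp
  finally show ?thesis by simp
qed

lemma mod_3_difference:
  fixes a b x y :: nat
  assumes "(a + x) mod 3 = (b + y) mod 3" "a < 3" "x < 3"
  shows "x = (y + (b + 3 - a) mod 3) mod 3"
proof -
  have "(y + (b + 3 - a) mod 3) mod 3 = (y + (b + 3 - a)) mod 3"
    by (simp only: mod_simps)
  also have "y + (b + 3 - a) = b + y + (3 - a)" using assms(2) by simp
  also have "\<dots> mod 3 = ((a + x) mod 3 + (3 - a)) mod 3"
    unfolding assms(1) by (simp only: mod_simps)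
  also have "\<dots> = (a + x + (3 - a)) mod 3" by (simp only: mod_simps)
  also have "a + x + (3 - a) = x + 3" using assms(2) by simp
  finally show ?thesis using assms(3) by simp
qed

lemma mod_3_cancel:
  fixes a x y :: nat
  assumes "(a + x) mod 3 = (a + y) mod 3" "a < 3" "x < 3" "y < 3"
  shows "x = y"
  using mod_3_difference[OF assms(1-3)] assms(4) by simp

section \<open>Squares in sequences, and the finite conditions checked on a block\<close>

definition square_at :: "(nat \<Rightarrow> nat) \<Rightarrow> nat \<Rightarrow> nat \<Rightarrow> bool" where
  "square_at s p k \<longleftrightarrow> (\<forall>i<p. s (k + i) = s (k + p + i))"

definition shift_subst :: "nat list \<Rightarrow> (nat \<Rightarrow> nat) \<Rightarrow> nat \<Rightarrow> nat" where
  "shift_subst u s n = (s (n div length u) + u ! (n mod length u)) mod 3"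

text \<open>Two consecutive blocks, normalized so that the first is unshifted; \<open>d\<close> is
  the difference of the two underlying letters.\<close>

definition two_blocks :: "nat list \<Rightarrow> nat \<Rightarrow> nat list" where
  "two_blocks u d = u @ map (\<lambda>x. (x + d) mod 3) u"

text \<open>Candidate factors beginning in the first block, tagged with their offset there. Only the
  differences 1 and 2 arise between adjacent distinct letters.\<close>

definition windows :: "nat list \<Rightarrow> nat \<Rightarrow> (nat \<times> nat list) list" where
  "windows u l =
     concat (map (\<lambda>d. map (\<lambda>r. (r, take l (drop r (two_blocks u d)))) [0..<length u]) [1,2])"

text \<open>A factor known only up to a cyclic shift reveals its offset in a block. The shift
  \<open>c\<close> accounts for first blocks that come from different letters.\<close>

definition synchronizing :: "nat list \<Rightarrow> nat \<Rightarrow> bool" where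
  "synchronizing u l \<longleftrightarrow> (\<forall>x\<in>set (windows u l). \<forall>y\<in>set (windows u l).
     \<forall>c\<in>set [0..<3]. snd x = map (\<lambda>i. (i + c) mod 3) (snd y) \<longrightarrow> fst x = fst y)"

definition short_square_free :: "nat list \<Rightarrow> nat \<Rightarrow> nat \<Rightarrow> bool" where
  "short_square_free u p0 l \<longleftrightarrow> (\<forall>d\<in>set [1,2]. \<forall>r\<in>set [0..<length u]. \<forall>p\<in>set [p0..<l].
     take p (drop r (two_blocks u d)) \<noteq> take p (drop (r + p) (two_blocks u d)))"

text \<open>Distinctness of adjacent letters leaves only two kinds of block pairs, which makes the
  finite checks sufficient.\<close>

locale ternary_subst =
  fixes u :: "nat list" and s :: "nat \<Rightarrow> nat"
  assumes u_nonempty: "u \<noteq> []"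
    and u_ternary: "x \<in> set u \<Longrightarrow> x < 3"
    and s_ternary: "s n < 3"
    and s_adjacent: "s (Suc n) \<noteq> s n"
begin

abbreviation "q \<equiv> length u"

definition jump :: "nat \<Rightarrow> nat" where
  "jump k = (s (Suc k) + 3 - s k) mod 3"

lemma jump_in: "jump k \<in> {1, 2}"
proof -
  have "jump k < 3" by (simp add: jump_def)
  moreover have "jump k \<noteq> 0"
  proof
    assume "jump k = 0"
    then show False
      using mod_3_add_difference[OF s_ternary, of "s (Suc k)" 0 k] s_ternary s_adjacent[of k]
      by (simp add: jump_def)
  qed
  ultimately show ?thesis by auto
qed

lemma length_two_blocks: "length (two_blocks u d) = 2 * q"
  by (simp add: two_blocks_def)

lemma two_blocks_ternary: "i < 2 * q \<Longrightarrow> two_blocks u d ! i < 3"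
  using u_ternary by (auto simp: two_blocks_def nth_append)

text \<open>A position reached by crossing at most one block boundary can be read in the normalized
  pair of blocks; the letter of the first block contributes a common shift.\<close>

lemma shift_subst_window:
  assumes "n mod q + i < 2 * q"
  shows "shift_subst u s (n + i) =
    (s (n div q) + two_blocks u (jump (n div q)) ! (n mod q + i)) mod 3"
proof -
  have q: "0 < q" using u_nonempty by simp
  have split: "n + i = (n mod q + i) + n div q * q" by simp
  have div: "(n + i) div q = n div q + (n mod q + i) div q"
    using q by (subst split, subst div_mult_self1) auto
  have mod: "(n + i) mod q = (n mod q + i) mod q"
    by (simp add: mod_add_left_eq)
  show ?thesis
  proof (cases "n mod q + i < q")
    case True
    then show ?thesis
      unfolding shift_subst_def div mod by (simp add: two_blocks_def nth_append)
  next
    case False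
    have j: "(n mod q + i) div q = 1" "(n mod q + i) mod q = n mod q + i - q"
      using False assms q by (simp_all add: le_div_geq le_mod_geq)
    have "(s (Suc (n div q)) + x) mod 3 = (s (n div q) + (x + jump (n div q)) mod 3) mod 3" for x
      using mod_3_add_difference[OF s_ternary[of "n div q"]] by (simp add: jump_def)
    then show ?thesis
      using False assms unfolding shift_subst_def div mod j by (simp add: two_blocks_def nth_append)
  qed
qed

text \<open>An offset is at most q - 1, so a window of length at most q + 1 stays inside two blocks.
  Both windows are therefore among those checked, up to a shift.\<close>

lemma synchronizingD:
  assumes "synchronizing u l" "l \<le> Suc q"
    and eq: "\<And>i. i < l \<Longrightarrow> shift_subst u s (m + i) = shift_subst u s (n + i)"
  shows "m mod q = n mod q"
proof -
  have q: "0 < q" using u_nonempty by simp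
  define T where "T k = two_blocks u (jump (k div q))" for k
  define win where "win k = take l (drop (k mod q) (T k))" for k
  have lt: "k mod q + i < 2 * q" if "i < l" for k i
    using that assms(2) mod_less_divisor[OF q, of k] by linarith
  have len: "length (win k) = l" for k
    using assms(2) mod_less_divisor[OF q, of k]
    by (simp add: win_def T_def length_two_blocks)
  have win_nth: "win k ! i = T k ! (k mod q + i)" if "i < l" for k i
    using that lt[OF that, of k] by (simp add: win_def T_def length_two_blocks)
  have mem: "(k mod q, win k) \<in> set (windows u l)" for k
    using jump_in[of "k div q"] mod_less_divisor[OF q, of k]
    by (auto simp: windows_def win_def T_def)
  \<comment> \<open>The shift is the difference of the letters underlying the two first
    blocks.\<close>
  define c where "c = (s (n div q) + 3 - s (m div q)) mod 3"
  have "win m = map (\<lambda>i. (i + c) mod 3) (win n)"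
  proof (rule nth_equalityI)
    fix i assume "i < length (win m)"
    then have i: "i < l" by (simp add: len)
    let ?x = "T m ! (m mod q + i)" and ?y = "T n ! (n mod q + i)"
    have "(s (m div q) + ?x) mod 3 = (s (n div q) + ?y) mod 3"
      using eq[OF i] by (simp add: shift_subst_window[OF lt[OF i]] T_def)
    moreover have "?x < 3"
      using two_blocks_ternary[OF lt[OF i]] by (simp add: T_def)
    ultimately have "?x = (?y + c) mod 3"
      unfolding c_def by (rule mod_3_difference[OF _ s_ternary])
    then show "win m ! i = map (\<lambda>i. (i + c) mod 3) (win n) ! i"
      using i by (simp add: win_nth len)
  qed (simp add: len)
  moreover have "c \<in> set [0..<3]" by (simp add: c_def)
  ultimately show ?thesis
    using assms(1)[unfolded synchronizing_def, THEN bspec, OF mem[of m],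
        THEN bspec, OF mem[of n], THEN bspec, of c] by simp
qed

text \<open>A period below \<open>l\<close> gives a square of length at most q + 1, which lies
  within two consecutive blocks wherever it starts. The shift of the first block cancels from both
  halves.\<close>

lemma short_square_freeD:
  assumes "short_square_free u p0 l" "2 * l \<le> q + 3" "p0 \<le> p" "p < l"
  shows "\<not> square_at (shift_subst u s) p n"
proof
  assume sq: "square_at (shift_subst u s) p n"
  have q: "0 < q" using u_nonempty by simp
  then have r: "n mod q < q" by simp
  define T where "T = two_blocks u (jump (n div q))"
  have lt: "n mod q + i < 2 * q" if "i < 2 * p" for i
    using that assms(2,4) r by linarith
  have T3: "T ! (n mod q + i) < 3" if "i < 2 * p" for i
    using two_blocks_ternary[OF lt[OF that]] by (simp add: T_def)
  have win: "shift_subst u s (n + i) = (s (n div q) + T ! (n mod q + i)) mod 3" if "i < 2 * p" for i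
    using shift_subst_window[OF lt[OF that]] by (simp add: T_def)
  have "n mod q + 2 * p \<le> 2 * q"
    using assms(2,4) r by linarith
  then have len: "length (take p (drop (n mod q) T)) = p" "length (take p (drop (n mod q + p) T)) = p"
    by (simp_all add: T_def length_two_blocks)
  have "take p (drop (n mod q) T) = take p (drop (n mod q + p) T)"
  proof (rule nth_equalityI)
    fix i assume "i < length (take p (drop (n mod q) T))"
    then have i: "i < p" by (simp add: len(1))
    have "shift_subst u s (n + i) = shift_subst u s (n + (p + i))"
      using sq i by (simp add: square_at_def add.assoc)
    then have "(s (n div q) + T ! (n mod q + i)) mod 3 = (s (n div q) + T ! (n mod q + (p + i))) mod 3"
      using win[of i] win[of "p + i"] i by simp
    then have "T ! (n mod q + i) = T ! (n mod q + (p + i))"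
      by (rule mod_3_cancel[OF _ s_ternary T3 T3]) (use i in simp_all)
    then show "take p (drop (n mod q) T) ! i = take p (drop (n mod q + p) T) ! i"
      using i len by (simp add: add.assoc)
  qed (simp only: len)
  moreover have "jump (n div q) \<in> set [1,2]" "n mod q \<in> set [0..<q]" "p \<in> set [p0..<l]"
    using jump_in[of "n div q"] r assms(3,4) by auto
  ultimately show False
    using assms(1)[unfolded short_square_free_def, THEN bspec, THEN bspec, THEN bspec]
    by (simp only: T_def)
qed

text \<open>Two occurrences of a long factor are congruent modulo the block length, so the period of a
  long square is a multiple of it. A single position of a block determines the underlying letter,
  hence the square descends to \<^term>\<open>s\<close>.\<close>

lemma square_descends:
  assumes "synchronizing u l" "l \<le> Suc q" "l \<le> p"
    and sq: "square_at (shift_subst u s) p n"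
  obtains m k where "p = q * m" "square_at s m k"
proof -
  have q: "0 < q" using u_nonempty by simp
  have "n mod q = (n + p) mod q"
    by (rule synchronizingD[OF assms(1,2)]) (use sq assms(3) in \<open>auto simp: square_at_def\<close>)
  then have "q dvd p"
    by (metis add_diff_cancel_left' mod_eq_dvd_iff_nat le_add1)
  then obtain m where m: "p = q * m" ..
  have "square_at s m (n div q)"
    unfolding square_at_def
  proof (intro allI impI)
    fix i assume "i < m"
    then have "q * i < p" using q m by simp
    then have "shift_subst u s (n + q * i) = shift_subst u s (n + p + q * i)"
      using sq by (simp add: square_at_def)
    also have "n + p + q * i = n + q * (m + i)"
      using m by (simp add: algebra_simps)
    finally have "shift_subst u s (n + q * i) = shift_subst u s (n + q * (m + i))" .
    then have "(s (n div q + i) + u ! (n mod q)) mod 3 = (s (n div q + (m + i)) + u ! (n mod q)) mod 3"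
      using q by (simp add: shift_subst_def ac_simps)
    then have "(u ! (n mod q) + s (n div q + i)) mod 3 = (u ! (n mod q) + s (n div q + (m + i))) mod 3"
      by (simp only: add.commute)
    moreover have "u ! (n mod q) < 3"
      using u_ternary q by simp
    ultimately have "s (n div q + i) = s (n div q + (m + i))"
      by (rule mod_3_cancel[OF _ _ s_ternary s_ternary])
    then show "s (n div q + i) = s (n div q + m + i)"
      by (simp only: add.assoc)
  qed
  with m show thesis by (rule that)
qed

end

section \<open>A square-free ternary sequence\<close>

text \<open>The palindromic block of Leech's square-free substitution of length 13.\<close>

definition leech_block :: "nat list" where
  "leech_block = [0,1,2,1,0,2,1,2,0,1,2,1,0]"

lemma length_leech_block [simp]: "length leech_block = 13"
  by (simp add: leech_block_def)

text \<open>The sum modulo 3 of the block entries at the base-13 digits of \<open>n\<close>. The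
  case 0 ends the recursion and agrees with the substitution because the block begins with
  0.\<close>

fun leech :: "nat \<Rightarrow> nat" where
  "leech n = (if n = 0 then 0 else (leech (n div 13) + leech_block ! (n mod 13)) mod 3)"

declare leech.simps [simp del]

lemma leech_fixed_point: "shift_subst leech_block leech = leech"
proof
  fix n
  have "leech 0 = 0" by (subst leech.simps) simp
  then show "shift_subst leech_block leech n = leech n"
    by (cases "n = 0") (simp_all add: shift_subst_def leech.simps[of n] leech_block_def)
qed

lemma leech_ternary: "leech n < 3"
  by (subst leech.simps) simp

lemma leech_adjacent: "leech (Suc n) \<noteq> leech n"
proof (induction n rule: less_induct)
  case (less n)
  have eq: "leech k = (leech (k div 13) + leech_block ! (k mod 13)) mod 3" for k
    using leech_fixed_point by (metis shift_subst_def length_leech_block)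
  show ?case
  proof (cases "n mod 13 = 12")
    \<comment> \<open>Here \<open>n\<close> and \<open>Suc n\<close> lie in different blocks. The
      block begins and ends with 0, so the two values are the underlying adjacent letters, covered
      by induction.\<close>
    case True
    then have "n div 13 < n" by (cases "n = 0") auto
    then have "leech (Suc (n div 13)) \<noteq> leech (n div 13)" by (rule less)
    moreover have "Suc n div 13 = Suc (n div 13)" "Suc n mod 13 = 0"
      using True by (simp_all add: div_Suc mod_Suc)
    ultimately show ?thesis
      using eq[of n] eq[of "Suc n"] True leech_ternary[of "n div 13"] leech_ternary[of "Suc (n div 13)"]
      by (simp add: leech_block_def)
  next
    case False
    then have "n mod 13 < 12" using mod_less_divisor[of 13 n] by linarith
    then have "n mod 13 \<in> set [0..<12]" by simp
    moreover have "\<forall>r\<in>set [0..<12]. leech_block ! Suc r \<noteq> leech_block ! r \<and>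
        leech_block ! Suc r < 3 \<and> leech_block ! r < 3"
      by code_simp
    ultimately have block: "leech_block ! Suc (n mod 13) \<noteq> leech_block ! (n mod 13)"
      "leech_block ! Suc (n mod 13) < 3" "leech_block ! (n mod 13) < 3"
      by blast+
    have suc: "Suc n div 13 = n div 13" "Suc n mod 13 = Suc (n mod 13)"
      using False by (auto simp: div_Suc mod_Suc)
    show ?thesis
    proof
      assume "leech (Suc n) = leech n"
      then have "(leech (n div 13) + leech_block ! Suc (n mod 13)) mod 3 =
        (leech (n div 13) + leech_block ! (n mod 13)) mod 3"
        using eq[of n] eq[of "Suc n"] suc by simp
      then show False
        using mod_3_cancel[OF _ leech_ternary block(2,3)] block(1) by blast
    qed
  qed
qed

text \<open>The threshold 8 is the largest with \<open>2 * l \<le> 13 + 3\<close>: squares of period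
  at most 7 fit into two blocks, and longer periods are left to synchronization.\<close>

lemma leech_synchronizing: "synchronizing leech_block 8"
  by code_simp

lemma leech_short_square_free: "short_square_free leech_block 1 8"
  by code_simp

interpretation leech: ternary_subst leech_block leech
  by unfold_locales (auto simp: leech_block_def leech_ternary leech_adjacent)

text \<open>Infinite descent on the period: a long square has period 13m and, the sequence being a
  fixed point, yields a square of period m in the same sequence.\<close>

lemma leech_square_free:
  assumes "0 < p"
  shows "\<not> square_at leech p n"
  using assms
proof (induction p arbitrary: n rule: less_induct)
  case (less p)
  show ?case
  proof (cases "p < 8")
    case True
    then show ?thesis
      using leech.short_square_freeD[OF leech_short_square_free, of p n] less.prems
      by (simp add: leech_fixed_point)
  next
    case False
    show ?thesis
    proof
      assume "square_at leech p n"
      then obtain m k where "p = 13 * m" "square_at leech m k"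
        using leech.square_descends[OF leech_synchronizing, of p n] False
        by (auto simp: leech_fixed_point)
      then show False using less.IH[of m k] less.prems by auto
    qed
  qed
qed

section \<open>A drifting sequence whose only squares have period one\<close>

text \<open>Inside the block each step is 0 or +1. The last entry is 1 and the next block begins
  with 1 or 2 relative to the current one, so the same holds across boundaries.\<close>

definition drift_block :: "nat list" where
  "drift_block = [0,1,1,1,2,2,0,1]"

definition drift :: "nat \<Rightarrow> nat" where
  "drift = shift_subst drift_block leech"

definition stay_or_succ :: "nat \<Rightarrow> nat \<Rightarrow> bool" where
  "stay_or_succ x y \<longleftrightarrow> x < 3 \<and> (y = x \<or> y = (x + 1) mod 3)"

text \<open>Two steps of +1 add 2, which is nonzero modulo 3, so no proper step can be
  undone.\<close>

lemma stay_or_succ_antisym: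
  assumes "stay_or_succ x y" "stay_or_succ y x"
  shows "x = y"
proof -
  have "x = 0 \<or> x = 1 \<or> x = 2" using assms(1) by (auto simp: stay_or_succ_def)
  then show ?thesis using assms by (elim disjE) (auto simp: stay_or_succ_def dest: dvd_imp_le)
qed

lemma length_drift_block [simp]: "length drift_block = 8"
  by (simp add: drift_block_def)

lemma drift_synchronizing: "synchronizing drift_block 5"
  by code_simp

text \<open>The checked periods start at 2 because the block itself contains repeated
  letters.\<close>

lemma drift_short_square_free: "short_square_free drift_block 2 5"
  by code_simp

interpretation drift: ternary_subst drift_block leech
  by unfold_locales (auto simp: drift_block_def leech_ternary leech_adjacent)

lemma drift_squares:
  assumes "2 \<le> p"
  shows "\<not> square_at drift p n"
proof (cases "p < 5")
  case True
  then show ?thesis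
    using drift.short_square_freeD[OF drift_short_square_free, of p n] assms
    by (simp add: drift_def)
next
  case False
  show ?thesis
  proof
    assume "square_at drift p n"
    then obtain m k where "p = 8 * m" "square_at leech m k"
      using drift.square_descends[OF drift_synchronizing, of p n] False
      by (auto simp: drift_def)
    then show False using leech_square_free[of m k] assms by auto
  qed
qed

lemma drift_ternary: "drift n < 3"
  by (simp add: drift_def shift_subst_def)

lemma drift_step: "stay_or_succ (drift n) (drift (Suc n))"
proof -
  let ?T = "two_blocks drift_block (drift.jump (n div 8))"
  \<comment> \<open>For \<open>r = 7\<close> the index \<open>r + 1\<close> is the first entry of
    the second block, so the boundary step is included.\<close>
  have "\<forall>d\<in>set [1,2]. \<forall>r\<in>set [0..<8]. two_blocks drift_block d ! (r + 1) \<in>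
      {two_blocks drift_block d ! r, (two_blocks drift_block d ! r + 1) mod 3}"
    by code_simp
  moreover have "drift.jump (n div 8) \<in> set [1,2]" "n mod 8 \<in> set [0..<8]"
    using drift.jump_in by simp_all
  ultimately have "?T ! (n mod 8 + 1) \<in> {?T ! (n mod 8), (?T ! (n mod 8) + 1) mod 3}"
    by blast
  moreover have "drift (n + i) = (leech (n div 8) + ?T ! (n mod 8 + i)) mod 3" if "i \<le> 1" for i
    using drift.shift_subst_window[of n i] that mod_less_divisor[of 8 n]
    by (simp add: drift_def)
  from this[of 0] this[of 1] have "drift n = (leech (n div 8) + ?T ! (n mod 8)) mod 3"
    "drift (Suc n) = (leech (n div 8) + ?T ! (n mod 8 + 1)) mod 3" by simp_all
  ultimately show ?thesis
    using drift_ternary[of n] unfolding stay_or_succ_def by (auto simp: mod_simps ac_simps)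
qed

section \<open>Avoidable patterns\<close>

lemma sublist_map_upt:
  assumes "sublist u (map s [0..<n])"
  obtains k where "u = map s [k..<k + length u]"
proof -
  obtain ps ss where eq: "map s [0..<n] = ps @ u @ ss"
    using assms by (auto simp: sublist_def)
  have len: "n = length ps + length u + length ss"
    using arg_cong[OF eq, of length] by simp
  have "u = take (length u) (drop (length ps) (map s [0..<n]))"
    by (simp add: eq)
  also have "\<dots> = map s [length ps..<length ps + length u]"
    by (simp add: drop_map take_map len)
  finally show thesis by (rule that)
qed

lemma square_at_of_sublist:
  assumes "sublist (A @ A) (map s [0..<n])"
  shows "\<exists>k. square_at s (length A) k"
proof -
  obtain k where k: "A @ A = map s [k..<k + length (A @ A)]"
    using assms by (rule sublist_map_upt)
  have "square_at s (length A) k"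
    unfolding square_at_def
  proof (intro allI impI)
    fix i assume i: "i < length A"
    have "(A @ A) ! i = s (k + i)" "(A @ A) ! (length A + i) = s (k + (length A + i))"
      using i by (simp_all add: arg_cong[OF k, of "\<lambda>u. u ! j" for j] del: append_assoc nth_append_length_plus)
    then show "s (k + i) = s (k + length A + i)"
      using i by (simp add: nth_append add.assoc)
  qed
  then show ?thesis ..
qed

lemma successively_sublist:
  assumes "successively R w" "sublist u w"
  shows "successively R u"
  using assms by (auto simp: sublist_def successively_append_iff)

lemma successively_map_upt:
  assumes "\<And>i. R (s i) (s (Suc i))"
  shows "successively R (map s [m..<n])"
  using assms by (auto simp: successively_conv_nth)

lemma successively_conj:
  "successively R u \<Longrightarrow> successively S u \<Longrightarrow> successively (\<lambda>x y. R x y \<and> S x y) u"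
  by (auto simp: successively_conv_nth)

lemma rev_eq_of_successively_eq: "successively (=) u \<Longrightarrow> rev u = u"
proof -
  assume "successively (=) u"
  then have "u = replicate (length u) (hd u)"
    by (induction u rule: induct_list012) auto
  then show ?thesis by (metis rev_replicate)
qed

lemma sublist_four_factors:
  assumes "sublist (A @ B @ C @ D) w"
  shows "sublist A w" "sublist B w" "sublist C w" "sublist D w"
proof -
  obtain ps ss where "w = ps @ (A @ B @ C @ D) @ ss"
    using assms by (auto simp: sublist_def)
  then have "w = ps @ A @ (B @ C @ D @ ss)" "w = (ps @ A) @ B @ (C @ D @ ss)"
    "w = (ps @ A @ B) @ C @ (D @ ss)" "w = (ps @ A @ B @ C) @ D @ ss" by simp_all
  then show "sublist A w" "sublist B w" "sublist C w" "sublist D w"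
    unfolding sublist_def by blast+
qed

lemma k_avoidable_3I:
  fixes s :: "nat \<Rightarrow> nat"
  assumes "\<And>n. s n < 3"
    and "\<And>A B n. A \<noteq> [] \<Longrightarrow> B \<noteq> [] \<Longrightarrow>
      sublist (pattern_image A B p) (map s [0..<n]) \<Longrightarrow> False"
  shows "k_avoidable 3 p"
  unfolding k_avoidable_def
proof
  fix n
  have "map s [0..<n] \<in> words 3" using assms(1) by (auto simp: words_def)
  moreover have "avoids 3 (map s [0..<n]) p" using assms(2) by (blast intro: avoidsI)
  ultimately show "\<exists>w\<in>words 3. n \<le> length w \<and> avoids 3 w p"
    by (intro bexI[of _ "map s [0..<n]"]) simp_all
qed

text \<open>Reading the reversal turns every step of \<open>A\<close> around. By antisymmetry all
  steps are trivial, so \<open>A\<close> is constant and hence a palindrome.\<close>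

lemma rev_eq_of_drift:
  assumes "sublist A (map drift [0..<n])" "sublist (rev A) (map drift [0..<n])"
  shows "rev A = A"
proof -
  have "successively stay_or_succ (map drift [0..<n])"
    by (rule successively_map_upt) (rule drift_step)
  then have "successively stay_or_succ A" "successively stay_or_succ (rev A)"
    using assms successively_sublist by blast+
  then have "successively (\<lambda>x y. stay_or_succ x y \<and> stay_or_succ y x) A"
    unfolding successively_rev by (rule successively_conj)
  then have "successively (=) A"
    by (rule successively_mono) (blast intro: stay_or_succ_antisym)
  then show ?thesis by (rule rev_eq_of_successively_eq)
qed

section \<open>Avoidable patterns of two and four letters\<close>

definition same_variable :: "letter \<Rightarrow> letter \<Rightarrow> bool" where
  "same_variable a b \<longleftrightarrow> (a \<in> {X, XR} \<longleftrightarrow> b \<in> {X, XR})"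

lemma letter_image_same_variable:
  assumes "same_variable a b"
  shows "letter_image A B b = letter_image A B a \<or> letter_image A B b = rev (letter_image A B a)"
  using assms by (cases a; cases b) (simp_all add: same_variable_def)

lemma letter_image_nonempty: "A \<noteq> [] \<Longrightarrow> B \<noteq> [] \<Longrightarrow> letter_image A B a \<noteq> []"
  by (cases a) simp_all

lemma two_letters_avoidable:
  assumes "same_variable a b"
  shows "k_avoidable 3 [a, b]"
proof (rule k_avoidable_3I[OF leech_ternary])
  fix A B :: "nat list" and n
  assume AB: "A \<noteq> []" "B \<noteq> []"
    and sub: "sublist (pattern_image A B [a, b]) (map leech [0..<n])"
  define C where "C = letter_image A B a"
  have "C \<noteq> []" using letter_image_nonempty[OF AB] by (simp add: C_def)
  have no_square: "\<not> sublist (D @ D) (map leech [0..<n])" if "D \<noteq> []" for D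
    using square_at_of_sublist[of D leech n] leech_square_free[of "length D"] that by auto
  from letter_image_same_variable[OF assms, of A B] show False
  proof
    assume "letter_image A B b = letter_image A B a"
    then show False using sub no_square[OF \<open>C \<noteq> []\<close>] by (simp add: C_def)
  next
    assume "letter_image A B b = rev (letter_image A B a)"
    then have "sublist (C @ rev C) (map leech [0..<n])" using sub by (simp add: C_def)
    \<comment> \<open>The last letter of \<open>C\<close> is doubled at the centre of
      \<open>C @ rev C\<close>.\<close>
    moreover obtain D x where "C = D @ [x]" using \<open>C \<noteq> []\<close> by (metis rev_exhaust)
    then have "C @ rev C = D @ ([x] @ [x]) @ rev D" by simp
    then have "sublist ([x] @ [x]) (C @ rev C)" unfolding sublist_def by blast
    ultimately show False using no_square[of "[x]"] sublist_order.order.trans by blast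
  qed
qed

lemma drift_avoids_square:
  assumes "A \<noteq> []" "B \<noteq> []"
  shows "\<not> sublist (A @ B @ A @ B) (map drift [0..<n])"
proof
  assume "sublist (A @ B @ A @ B) (map drift [0..<n])"
  then obtain k where "square_at drift (length (A @ B)) k"
    using square_at_of_sublist[of "A @ B"] by auto
  moreover have "2 \<le> length (A @ B)"
    using assms by (cases A; cases B) simp_all
  ultimately show False using drift_squares by blast
qed

text \<open>If the two images of a variable differ, they are reversals of each other and both occur,
  hence equal after all. The instance is then a square whose period is at least 2.\<close>

lemma four_letters_avoidable:
  assumes "same_variable a c" "same_variable b d"
  shows "k_avoidable 3 [a, b, c, d]"
proof (rule k_avoidable_3I[OF drift_ternary])
  fix A B :: "nat list" and n
  assume AB: "A \<noteq> []" "B \<noteq> []"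
    and "sublist (pattern_image A B [a, b, c, d]) (map drift [0..<n])"
  then have sub: "sublist (letter_image A B a @ letter_image A B b @
      letter_image A B c @ letter_image A B d) (map drift [0..<n])" by simp
  have "letter_image A B c = letter_image A B a" "letter_image A B d = letter_image A B b"
    using letter_image_same_variable[OF assms(1), of A B] letter_image_same_variable[OF assms(2), of A B]
      rev_eq_of_drift sublist_four_factors[OF sub] by metis+
  then show False
    using sub drift_avoids_square letter_image_nonempty[OF AB] by metis
qed

section \<open>Least representatives and the classification\<close>

lemma ell_minimal:
  "ell p \<le> iota1 (ell p)" "ell p \<le> iota2 (ell p)" "ell p \<le> iota2 (iota1 (iota2 (ell p)))"
proof -
  have step: "sim p (iota1 q)" "sim p (iota2 q)" if "sim p q" for q
    using that unfolding sim_def by (auto simp: iota_step_def intro: rtranclp.rtrancl_into_rtrancl)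
  show "ell p \<le> iota1 (ell p)" "ell p \<le> iota2 (ell p)" "ell p \<le> iota2 (iota1 (iota2 (ell p)))"
    by (intro ell_le step sim_ell)+
qed

text \<open>The first two inequalities force a nonempty pattern to begin with \<open>X\<close>; the
  third, which reverses only the second variable, then rules out \<open>YR\<close> as the second
  letter.\<close>

lemma avoidable_or_prefix:
  assumes "p \<le> iota1 p" "p \<le> iota2 p" "p \<le> iota2 (iota1 (iota2 p))"
  shows "k_avoidable 3 p \<or> prefix p [X, Y, X] \<or> prefix p [X, Y, XR]"
proof -
  note le = assms[unfolded iota1_def iota2_def]
  have pair: "k_avoidable 3 p" if "sublist [a, b] p" "same_variable a b" for a b
    using k_avoidable_sublist[OF two_letters_avoidable that(1)] that(2) .
  consider "p = []" | a where "p = [a]" | a b where "p = [a, b]" | a b c where "p = [a, b, c]"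
    | a b c d r where "p = a # b # c # d # r"
    by (metis neq_Nil_conv)
  then show ?thesis
  proof cases
    case 1
    then show ?thesis by simp
  next
    case (2 a)
    then show ?thesis
      using le by (cases a) (auto simp: less_letter_def)
  next
    case (3 a b)
    have "sublist [a, b] p" using 3 by simp
    with pair[of a b] show ?thesis
      using le unfolding 3 by (cases a; cases b) (auto simp: less_letter_def same_variable_def)
  next
    case (4 a b c)
    have "p = [] @ [a, b] @ [c]" "p = [a] @ [b, c] @ []" using 4 by simp_all
    then have "sublist [a, b] p" "sublist [b, c] p" unfolding sublist_def by blast+
    with pair[of a b] pair[of b c] show ?thesis
      using le unfolding 4
      by (cases a; cases b; cases c) (auto simp: less_letter_def same_variable_def)
  next
    case (5 a b c d r)
    have "p = [] @ [a, b] @ c # d # r" "p = [a] @ [b, c] @ d # r" "p = [a, b] @ [c, d] @ r"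
      "p = [] @ [a, b, c, d] @ r" using 5 by simp_all
    then have sub: "sublist [a, b] p" "sublist [b, c] p" "sublist [c, d] p" "sublist [a, b, c, d] p"
      unfolding sublist_def by blast+
    \<comment> \<open>If no two adjacent letters share a variable, the four letters alternate
      between the two variables.\<close>
    consider "same_variable a b" | "same_variable b c" | "same_variable c d"
      | "same_variable a c" "same_variable b d"
      unfolding same_variable_def by blast
    then have "k_avoidable 3 p"
      using pair sub k_avoidable_sublist four_letters_avoidable by cases blast+
    then show ?thesis ..
  qed
qed

theorem theorem7:
  fixes p :: pattern
  shows "((prefix (ell p) [X, Y, X] \<or> prefix (ell p) [X, Y, XR]) \<longrightarrow> unavoidable p) \<and>
         (\<not> (prefix (ell p) [X, Y, X] \<or> prefix (ell p) [X, Y, XR]) \<longrightarrow> k_avoidable 3 p)"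
proof (intro conjI impI)
  assume pre: "prefix (ell p) [X, Y, X] \<or> prefix (ell p) [X, Y, XR]"
  have "\<not> k_avoidable k p" for k
  proof
    assume "k_avoidable k p"
    then have "k_avoidable k (ell p)" using k_avoidable_sim[OF sim_ell] by blast
    \<comment> \<open>Avoidability passes from a factor to any longer pattern, so prefixes of an
      unavoidable pattern are unavoidable.\<close>
    then show False
      using pre k_avoidable_sublist[OF _ prefix_imp_sublist] unavoidable_maximal by blast
  qed
  then show "unavoidable p" by (simp add: unavoidable_def avoidable_def)
next
  assume "\<not> (prefix (ell p) [X, Y, X] \<or> prefix (ell p) [X, Y, XR])"
  then have "k_avoidable 3 (ell p)" using avoidable_or_prefix[OF ell_minimal] by blast
  then show "k_avoidable 3 p" using k_avoidable_sim[OF sim_ell] by blast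
qed

end
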